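(* Let $p$ be a prime, $q=p^e$ with $e\ge1$, and $m$ an integer with $1\le m\le e$. Let $L_m(q)$ be the bipartite graph whose vertex set is the disjoint union of a point set $\mathbb{F}_q^{m+1}$ and a line set $\mathbb{F}_q^{m+1}$, with a point $P=(p_1,\dots,p_{m+1})$ adjacent to a line $L=[l_1,\dots,l_{m+1}]$ if and only if $l_k+p_k=p_1^{\,p^{k-2}}\,l_1$ for all $k=2,\dots,m+1$. Then the diameter of $L_m(q)$ is $2(m+1)$.
   Context: The diameter is the maximum over pairs of vertices of the length of a shortest path between them. *)

theory Defs
  imports
    "HOL-Computational_Algebra.Primes"
    "HOL-Library.FuncSet"
    "Graph_Theory.Graph_Theory"
begin

text \<open>
  Undirected graphs are represented as symmetric digraphs, as in the library. With unit
  weights the cost of a walk is its number of edges, so the library's shortest-path function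
  \<open>\<mu>\<close> is the usual graph distance; it is infinite between vertices of different
  components.
\<close>

definition diameter :: "('v, 'b) pre_digraph \<Rightarrow> ereal" where
  "diameter G = (SUP (u, v) \<in> verts G \<times> verts G. wf_digraph.\<mu> G (\<lambda>_. 1) u v)"

lemma (in fin_digraph) diameter_eq_Max:
  assumes "verts G \<noteq> {}"
  shows "diameter G = Max ((\<lambda>(u, v). \<mu> (\<lambda>_. 1) u v) ` (verts G \<times> verts G))"
  unfolding diameter_def using assms by (intro Max_Sup[symmetric]) auto

text \<open>
  Vectors of length \<open>n\<close> over \<open>'a\<close> with coordinates numbered \<open>1, \<dots>, n\<close>; extensionality
  (the value \<open>undefined\<close> outside of the index range) makes the representation unique.
\<close>

abbreviation vecs :: "nat \<Rightarrow> (nat \<Rightarrow> 'a) set" where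
  "vecs n \<equiv> {1..n} \<rightarrow>\<^sub>E UNIV"

definition incident :: "nat \<Rightarrow> nat \<Rightarrow> (nat \<Rightarrow> 'a::field) \<Rightarrow> (nat \<Rightarrow> 'a) \<Rightarrow> bool" where
  "incident p m P L \<longleftrightarrow> (\<forall>k\<in>{2..m + 1}. L k + P k = P 1 ^ (p ^ (k - 2)) * L 1)"

text \<open>
  The points are the vertices \<open>Inl P\<close>, the lines the vertices \<open>Inr L\<close>. The prime \<open>p\<close> is a
  parameter; the field with \<open>q\<close> elements is the type \<open>'a\<close>.
\<close>

definition linearized_Wenger_graph ::
  "nat \<Rightarrow> nat \<Rightarrow> ((nat \<Rightarrow> 'a::field) + (nat \<Rightarrow> 'a)) pair_pre_digraph" where
  "linearized_Wenger_graph p m =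
    \<lparr> pverts = vecs (m + 1) <+> vecs (m + 1),
      parcs = (\<Union>P\<in>vecs (m + 1). \<Union>L\<in>{L \<in> vecs (m + 1). incident p m P L}.
        {(Inl P, Inr L), (Inr L, Inl P)}) \<rparr>"

lemma pair_graph_linearized_Wenger_graph:
  "pair_graph (linearized_Wenger_graph p m ::
    ((nat \<Rightarrow> 'a::{field, finite}) + (nat \<Rightarrow> 'a)) pair_pre_digraph)"
    (is "pair_graph ?G")
proof -
  have fin: "finite (vecs (m + 1) :: (nat \<Rightarrow> 'a) set)"
    by (intro finite_PiE) auto
  have wf: "parcs ?G \<subseteq> pverts ?G \<times> pverts ?G"
    by (auto simp: linearized_Wenger_graph_def)
  have finv: "finite (pverts ?G)"
    using fin by (simp add: linearized_Wenger_graph_def)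
  show ?thesis
  proof
    show "finite (parcs ?G)"
      using finite_subset[OF wf] finv by blast
    show "symmetric (with_proj ?G)"
      by (auto simp: symmetric_def sym_def linearized_Wenger_graph_def)
  qed (use wf finv in \<open>auto simp: linearized_Wenger_graph_def\<close>)
qed

end

(* A monic affine p-polynomial of degree p^n is f(t) = d + sum_{j<n} a_j t^(p^j) + t^(p^n). Passing
   from f to f^p - f(x)^(p-1) f keeps the roots and adds the root x, so some such f vanishes at any
   n + 1 given field elements.

   Upper bound. Walking from a point P to a line L through points with first coordinates
   x_1, ..., x_m, starting at x_0 = P_1, amounts to solving the linear system sum_i s_i = L_1,
   sum_i s_i x_i^(p^j) = L_(j+2) + P_(j+2) for j < m. Choosing every new x_i as a non-root of a monic
   affine p-polynomial of degree p^(i-1) < q vanishing at the earlier nodes makes it solvable, so a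
   point and a line are joined by a walk of length 2m+1.

   Lower bound. If f vanishes at the first coordinates of all points of a walk between lines, then
   the functional d L_1 + sum_j a_j L_(j+2) is constant on its lines. A walk of length at most 2m has
   at most m points, and the monic f of degree p^(m-1) vanishing at them separates the zero line
   from the line with last coordinate 1. *)

theory Submission
  imports Defs "HOL-Computational_Algebra.Polynomial"
begin

section \<open>Characteristic and affine p-polynomials\<close>

text \<open>Translation by 1 permutes the ring, so it preserves the sum of all elements.\<close>

lemma of_nat_card_eq_0:
  "of_nat (card (UNIV :: 'a set)) = (0 :: 'a :: {comm_ring_1, finite})"
proof -
  have "(\<Sum>x\<in>UNIV. x + 1) = (\<Sum>x\<in>UNIV. x :: 'a)"
    by (rule sum.reindex_bij_witness[of _ "\<lambda>x. x - 1" "\<lambda>x. x + 1"]) auto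
  then show ?thesis
    by (simp add: sum.distrib)
qed

lemma CHAR_eq_if_card_eq_prime_power:
  assumes "prime p" and "card (UNIV :: 'a::{field, finite} set) = p ^ e"
  shows "CHAR('a) = p"
proof -
  have "CHAR('a) > 0"
    by (intro finite_imp_CHAR_pos) simp
  then have "prime CHAR('a)"
    by (rule prime_CHAR_semidom)
  moreover have "CHAR('a) dvd p ^ e"
    using of_nat_card_eq_0[where 'a = 'a] unfolding assms(2) of_nat_eq_0_iff_char_dvd .
  ultimately show ?thesis
    using assms(1) prime_dvd_power primes_dvd_imp_eq by blast
qed

definition affine_p_poly :: "nat \<Rightarrow> nat \<Rightarrow> (nat \<Rightarrow> 'a::comm_ring_1) \<Rightarrow> 'a \<Rightarrow> 'a \<Rightarrow> 'a" where
  "affine_p_poly p n a d x = d + (\<Sum>j<n. a j * x ^ (p ^ j)) + x ^ (p ^ n)"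

lemma ex_affine_p_poly_vanishing:
  fixes X :: "'a::field set"
  assumes p: "prime p" and char: "CHAR('a) = p"
    and "finite X" and "card X \<le> Suc n"
  shows "\<exists>a d. \<forall>x\<in>X. affine_p_poly p n a d x = 0"
  using assms(3,4)
proof (induction n arbitrary: X)
  case 0
  show ?case
  proof (cases "X = {}")
    case False
    with 0 have "card X = 1"
      by (simp add: le_Suc_eq)
    then obtain x where X: "X = {x}"
      by (rule card_1_singletonE)
    \<comment> \<open>For \<open>n = 0\<close> the polynomial is just \<open>t + d\<close>.\<close>
    show ?thesis
      unfolding X affine_p_poly_def by (intro exI[of _ "\<lambda>_. 0"] exI[of _ "- x"]) simp
  qed simp
next
  case (Suc n)
  show ?case
  proof (cases "X = {}")
    case False
    then obtain x Y where X: "X = insert x Y" and "x \<notin> Y"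
      by (meson Set.set_insert equals0I)
    with Suc.prems have "finite Y" "card Y \<le> Suc n"
      by auto
    from Suc.IH[OF this] obtain a d where van: "\<And>y. y \<in> Y \<Longrightarrow> affine_p_poly p n a d y = 0"
      by blast
    define f where "f = affine_p_poly p n a d"
    define c where "c = f x ^ (p - 1)"
    \<comment> \<open>Coefficients of \<open>f^p - c f\<close>: Frobenius shifts indices up by one,
      and \<open>j = n\<close> is the monic term of \<open>f\<close>.\<close>
    define a' where "a' j = (case j of 0 \<Rightarrow> 0 | Suc i \<Rightarrow> a i ^ p) - c * (if j = n then 1 else a j)" for j
    have frob: "affine_p_poly p (Suc n) a' (d ^ p - c * d) y = f y ^ p - c * f y" for y
    proof -
      have "f y ^ p = d ^ p + (\<Sum>j<n. (a j * y ^ (p ^ j)) ^ p) + (y ^ (p ^ n)) ^ p"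
        unfolding f_def affine_p_poly_def
        using p char by (simp add: freshmans_dream freshmans_dream_sum)
      also have "\<dots> = d ^ p + (\<Sum>j<n. a j ^ p * y ^ (p ^ Suc j)) + y ^ (p ^ Suc n)"
        by (simp add: power_mult_distrib mult.commute flip: power_mult)
      also have "(\<Sum>j<n. a j ^ p * y ^ (p ^ Suc j))
          = (\<Sum>j<Suc n. (case j of 0 \<Rightarrow> 0 | Suc i \<Rightarrow> a i ^ p) * y ^ (p ^ j))"
        by (subst sum.lessThan_Suc_shift) simp
      finally have 1: "f y ^ p = d ^ p
          + (\<Sum>j<Suc n. (case j of 0 \<Rightarrow> 0 | Suc i \<Rightarrow> a i ^ p) * y ^ (p ^ j)) + y ^ (p ^ Suc n)" .
      have 2: "c * f y = c * d + (\<Sum>j<Suc n. c * (if j = n then 1 else a j) * y ^ (p ^ j))"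
        by (simp add: f_def affine_p_poly_def algebra_simps sum_distrib_left)
      show ?thesis
        unfolding 1 2 unfolding affine_p_poly_def a'_def left_diff_distrib sum_subtractf by simp
    qed
    have "p = Suc (p - 1)"
      using prime_gt_0_nat[OF p] by simp
    then have "f x ^ p = c * f x"
      unfolding c_def by (metis power_Suc2)
    then have "affine_p_poly p (Suc n) a' (d ^ p - c * d) y = 0" if "y \<in> X" for y
      using that van prime_gt_0_nat[OF p] unfolding frob by (auto simp: X f_def zero_power)
    then show ?thesis
      by blast
  qed simp
qed

text \<open>Otherwise a nonzero polynomial of degree at most \<open>p ^ n\<close> would have
  \<open>p ^ e\<close> roots.\<close>

lemma ex_affine_p_poly_nonzero:
  fixes a :: "nat \<Rightarrow> 'a::{field, finite}"
  assumes "prime p" and "card (UNIV :: 'a set) = p ^ e" and "n < e"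
  shows "\<exists>x. affine_p_poly p n a d x \<noteq> 0"
proof (rule ccontr)
  assume zero: "\<not> ?thesis"
  define g where "g = [:d:] + (\<Sum>j<n. monom (a j) (p ^ j)) + monom 1 (p ^ n)"
  have p1: "p > 1"
    using assms(1) by (rule prime_gt_1_nat)
  have "poly g x = affine_p_poly p n a d x" for x
    by (simp add: g_def affine_p_poly_def poly_sum poly_monom)
  with zero have roots: "{x. poly g x = 0} = UNIV"
    by auto
  have "coeff g (p ^ n) = 1"
    using p1 by (simp add: g_def coeff_sum coeff_pCons split: nat.split)
  then have "g \<noteq> 0"
    by auto
  then have "p ^ e \<le> degree g"
    using card_poly_roots_bound[of g] by (simp add: roots assms(2))
  also have "degree g \<le> p ^ n"
    unfolding g_def using p1
    by (intro degree_add_le degree_sum_le order.trans[OF degree_monom_le]) (auto intro: power_increasing)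
  also have "p ^ n < p ^ e"
    using p1 assms(3) by simp
  finally show False
    by simp
qed

section \<open>Solving the linear system\<close>

text \<open>Expresses weighted values of the polynomial through the sums prescribed by the system;
  nodes that are roots drop out on the left.\<close>

lemma sum_affine_p_poly:
  "(\<Sum>i\<in>I. s i * affine_p_poly p n a d (x i))
    = d * (\<Sum>i\<in>I. s i) + (\<Sum>j<n. a j * (\<Sum>i\<in>I. s i * x i ^ (p ^ j)))
      + (\<Sum>i\<in>I. s i * x i ^ (p ^ n))"
proof -
  have "(\<Sum>j<n. a j * (\<Sum>i\<in>I. s i * x i ^ (p ^ j))) = (\<Sum>i\<in>I. s i * (\<Sum>j<n. a j * x i ^ (p ^ j)))"
    unfolding sum_distrib_left by (subst sum.swap) (simp add: mult_ac)
  then show ?thesis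
    by (simp add: affine_p_poly_def distrib_left sum.distrib sum_distrib_left mult_ac)
qed

text \<open>
  Each new node is a non-root of a monic affine \<open>p\<close>-polynomial vanishing at the earlier nodes,
  which makes the system triangular.
\<close>

lemma ex_interpolation_nodes:
  fixes x0 :: "'a::{field, finite}"
  assumes p: "prime p" and card: "card (UNIV :: 'a set) = p ^ e" and "n \<le> e"
  shows "\<exists>x. x 0 = x0 \<and>
    (\<forall>b c. \<exists>s. (\<Sum>i\<le>n. s i) = b \<and> (\<forall>j<n. (\<Sum>i\<le>n. s i * x i ^ (p ^ j)) = c j))"
  using assms(3)
proof (induction n)
  case 0
  have "\<exists>s. s 0 = b" for b :: 'a
    by (rule exI[of _ "\<lambda>_. b"]) simp
  then show ?case
    by auto
next
  case (Suc n)
  then obtain x where x0: "x 0 = x0" and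
    solve: "\<And>b c. \<exists>s. (\<Sum>i\<le>n. s i) = b \<and> (\<forall>j<n. (\<Sum>i\<le>n. s i * x i ^ (p ^ j)) = c j)"
    by auto
  have "card (x ` {..n}) \<le> Suc n"
    using card_image_le[of "{..n}" x] by simp
  then obtain a d where van: "\<And>i. i \<le> n \<Longrightarrow> affine_p_poly p n a d (x i) = 0"
    using ex_affine_p_poly_vanishing[OF p CHAR_eq_if_card_eq_prime_power[OF p card], of "x ` {..n}" n]
    by auto
  obtain z where z: "affine_p_poly p n a d z \<noteq> 0"
    using ex_affine_p_poly_nonzero[OF p card, of n] Suc.prems by (auto simp: Suc_le_eq)
  define x' where "x' = x(Suc n := z)"
  have "\<exists>s. (\<Sum>i\<le>Suc n. s i) = b \<and> (\<forall>j<Suc n. (\<Sum>i\<le>Suc n. s i * x' i ^ (p ^ j)) = c j)" for b c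
  proof -
    \<comment> \<open>Combining the equations with the coefficients of the polynomial cancels the
      old nodes and leaves \<open>t\<close> times its value at \<open>z\<close>, which forces
      \<open>t\<close>.\<close>
    define t where "t = (d * b + (\<Sum>j<n. a j * c j) + c n) / affine_p_poly p n a d z"
    obtain s where s: "(\<Sum>i\<le>n. s i) = b - t" "\<And>j. j < n \<Longrightarrow> (\<Sum>i\<le>n. s i * x i ^ (p ^ j)) = c j - t * z ^ (p ^ j)"
      using solve[of "b - t" "\<lambda>j. c j - t * z ^ (p ^ j)"] by blast
    define s' where "s' = s(Suc n := t)"
    have sum: "(\<Sum>i\<le>Suc n. s' i) = b"
      by (simp add: s'_def s)
    have low: "(\<Sum>i\<le>Suc n. s' i * x' i ^ (p ^ j)) = c j" if "j < n" for j
      using that by (simp add: s'_def x'_def s)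
    \<comment> \<open>The last equation enters the combination with coefficient 1, so it follows
      from the others and the choice of \<open>t\<close>.\<close>
    have "d * b + (\<Sum>j<n. a j * c j) + (\<Sum>i\<le>Suc n. s' i * x' i ^ (p ^ n))
        = (\<Sum>i\<le>Suc n. s' i * affine_p_poly p n a d (x' i))"
      unfolding sum_affine_p_poly sum using low by simp
    also have "\<dots> = t * affine_p_poly p n a d z"
      by (simp add: s'_def x'_def van)
    also have "\<dots> = d * b + (\<Sum>j<n. a j * c j) + c n"
      using z by (simp add: t_def)
    finally have "(\<Sum>i\<le>Suc n. s' i * x' i ^ (p ^ n)) = c n"
      by simp
    with sum low show ?thesis
      by (intro exI[of _ s']) (auto simp: less_Suc_eq simp del: sum.atMost_Suc)
  qed
  moreover have "x' 0 = x0"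
    by (simp add: x'_def x0)
  ultimately show ?case
    by blast
qed

section \<open>Coordinates and incidence\<close>

text \<open>The shift by 2 matches coordinates with the exponents \<open>p ^ j\<close> of affine
  p-polynomials.\<close>

lemma incident_iff:
  "incident p m P L \<longleftrightarrow>
    (\<forall>j<m. L (Suc (Suc j)) + P (Suc (Suc j)) = P (Suc 0) ^ (p ^ j) * L (Suc 0))"
proof -
  have "k \<in> (\<lambda>j. Suc (Suc j)) ` {..<m}" if "k \<in> {2..m + 1}" for k
    using that by (intro image_eqI[of _ _ "k - 2"]) auto
  then have "{2..m + 1} = (\<lambda>j. Suc (Suc j)) ` {..<m}"
    by auto
  then show ?thesis
    by (auto simp: incident_def)
qed

definition vec :: "nat \<Rightarrow> 'a \<Rightarrow> (nat \<Rightarrow> 'a) \<Rightarrow> nat \<Rightarrow> 'a" where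
  "vec m b c = restrict (\<lambda>k. if k = 1 then b else c (k - 2)) {1..m + 1}"

lemma vec_in_vecs [simp]: "vec m b c \<in> {Suc 0..Suc m} \<rightarrow>\<^sub>E UNIV"
  by (auto simp: vec_def)

lemma vec_nth [simp]: "vec m b c (Suc 0) = b" "j < m \<Longrightarrow> vec m b c (Suc (Suc j)) = c j"
  by (auto simp: vec_def)

text \<open>With first coordinate 0 the equations determine the others. This supplies the extra edge
  for walks between vertices on the same side.\<close>

lemma ex_incident:
  fixes P L :: "nat \<Rightarrow> 'a::field"
  shows "\<exists>P\<in>vecs (Suc m). incident p m P L" and "\<exists>L\<in>vecs (Suc m). incident p m P L"
proof -
  show "\<exists>P\<in>vecs (Suc m). incident p m P L"
    by (intro bexI[of _ "vec m 0 (\<lambda>j. 0 ^ (p ^ j) * L (Suc 0) - L (Suc (Suc j)))"])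
      (simp_all add: incident_iff)
  show "\<exists>L\<in>vecs (Suc m). incident p m P L"
    by (intro bexI[of _ "vec m 0 (\<lambda>j. - P (Suc (Suc j)))"]) (simp_all add: incident_iff)
qed

lemma vecs_eqI:
  assumes "u \<in> vecs (Suc m)" "v \<in> vecs (Suc m)"
    and "u (Suc 0) = v (Suc 0)" "\<And>j. j < m \<Longrightarrow> u (Suc (Suc j)) = v (Suc (Suc j))"
  shows "u = v"
proof (rule PiE_ext[OF assms(1,2)])
  fix k assume "k \<in> {1..Suc m}"
  then consider "k = Suc 0" | j where "k = Suc (Suc j)" "j < m"
    by (cases k; cases "k - 1") auto
  then show "u k = v k"
    using assms(3,4) by cases auto
qed

section \<open>Walks and the invariant functional\<close>

lemma length_rev_path [simp]: "length (rev_path w) = length w"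
  by (induction w) auto

lemma (in wf_digraph) awalk_cost_one: "awalk_cost (\<lambda>_. 1) w = real (length w)"
  by (simp add: awalk_cost_def sum_list_triv)

text \<open>
  The linear functional on lines with the coefficients of an affine \<open>p\<close>-polynomial, extended to
  points so that incidence at a point whose first coordinate is a root preserves it.
\<close>

definition functional :: "nat \<Rightarrow> (nat \<Rightarrow> 'a) \<Rightarrow> 'a \<Rightarrow> (nat \<Rightarrow> 'a::field) + (nat \<Rightarrow> 'a) \<Rightarrow> 'a" where
  "functional n a d v = (case v of
      Inl P \<Rightarrow> - (\<Sum>j<n. a j * P (Suc (Suc j))) - P (Suc (Suc n))
    | Inr L \<Rightarrow> d * L (Suc 0) + (\<Sum>j<n. a j * L (Suc (Suc j))) + L (Suc (Suc n)))"

text \<open>After substituting the incidence equations, the two values differ by \<open>L 1\<close>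
  times the polynomial at \<open>P 1\<close>.\<close>

lemma functional_eq_if_incident:
  assumes "incident p (Suc n) P L" and "affine_p_poly p n a d (P (Suc 0)) = 0"
  shows "functional n a d (Inl P) = functional n a d (Inr L)"
proof -
  have inc: "L (Suc (Suc j)) = P (Suc 0) ^ (p ^ j) * L (Suc 0) - P (Suc (Suc j))" if "j < Suc n" for j
    using assms(1) that by (auto simp: incident_iff eq_diff_eq)
  have "functional n a d (Inr L) - functional n a d (Inl P)
      = L (Suc 0) * affine_p_poly p n a d (P (Suc 0))"
    by (simp add: functional_def affine_p_poly_def inc algebra_simps sum_distrib_left sum_subtractf)
  with assms(2) show ?thesis
    by simp
qed

section \<open>Upper bound\<close>

context
  fixes p e m :: nat and G :: "((nat \<Rightarrow> 'a::{field, finite}) + (nat \<Rightarrow> 'a)) pair_pre_digraph"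
  assumes p: "prime p" and card: "card (UNIV :: 'a set) = p ^ e" and m: "1 \<le> m" "m \<le> e"
  defines "G \<equiv> linearized_Wenger_graph p m"
begin

interpretation pair_graph G
  unfolding G_def by (rule pair_graph_linearized_Wenger_graph)

lemma G_simps:
  "(Inl P, Inr L) \<in> parcs G \<longleftrightarrow> P \<in> vecs (Suc m) \<and> L \<in> vecs (Suc m) \<and> incident p m P L"
  "(Inr L, Inl P) \<in> parcs G \<longleftrightarrow> P \<in> vecs (Suc m) \<and> L \<in> vecs (Suc m) \<and> incident p m P L"
  "(Inl P, Inl P') \<notin> parcs G" "(Inr L, Inr L') \<notin> parcs G"
  "Inl P \<in> pverts G \<longleftrightarrow> P \<in> vecs (Suc m)" "Inr L \<in> pverts G \<longleftrightarrow> L \<in> vecs (Suc m)"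
  by (auto simp: G_def linearized_Wenger_graph_def)

text \<open>
  The intermediate points have the first coordinates \<open>x 1, \<dots>, x m\<close>, and \<open>s i\<close> is the
  change of the first coordinate from one line to the next.
\<close>

lemma ex_awalk_point_line:
  assumes P: "P \<in> vecs (Suc m)" and L: "L \<in> vecs (Suc m)"
  shows "\<exists>w. awalk (Inl P) w (Inr L) \<and> length w = 2 * m + 1"
proof -
  obtain x where x0: "x 0 = P (Suc 0)" and
    solve: "\<And>b c. \<exists>s. (\<Sum>i\<le>m. s i) = b \<and> (\<forall>j<m. (\<Sum>i\<le>m. s i * x i ^ (p ^ j)) = c j)"
    using ex_interpolation_nodes[OF p card m(2), of "P (Suc 0)"] by blast
  obtain s where s: "(\<Sum>i\<le>m. s i) = L (Suc 0)"
    "\<And>j. j < m \<Longrightarrow> (\<Sum>i\<le>m. s i * x i ^ (p ^ j)) = L (Suc (Suc j)) + P (Suc (Suc j))"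
    using solve[of "L (Suc 0)" "\<lambda>j. L (Suc (Suc j)) + P (Suc (Suc j))"] by blast
  \<comment> \<open>Two lines through a point with first coordinate \<open>x\<close> differ by
    \<open>s\<close> in the first coordinate and by \<open>s * x ^ (p ^ j)\<close> in coordinate
    \<open>j + 2\<close>; \<open>ln\<close> accumulates these changes, starting from a line through
    \<open>P\<close>.\<close>
  define ln where
    "ln n = vec m (\<Sum>i\<le>n. s i) (\<lambda>j. (\<Sum>i\<le>n. s i * x i ^ (p ^ j)) - P (Suc (Suc j)))" for n
  \<comment> \<open>The point on \<open>ln n\<close> with first coordinate \<open>x n\<close>; for
    positive \<open>n\<close> it also lies on the preceding line.\<close>
  define pt where
    "pt n = vec m (x n) (\<lambda>j. x n ^ (p ^ j) * ln n (Suc 0) - ln n (Suc (Suc j)))" for n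
  have "\<exists>w. awalk (Inl P) w (Inr (ln n)) \<and> length w = 2 * n + 1" for n
  proof (induction n)
    case 0
    have "incident p m P (ln 0)"
      by (simp add: incident_iff ln_def x0 mult.commute)
    then have "awalk (Inl P) [(Inl P, Inr (ln 0))] (Inr (ln 0))"
      using P by (simp add: awalk_simps G_simps ln_def)
    then show ?case
      by (intro exI[of _ "[(Inl P, Inr (ln 0))]"]) simp
  next
    case (Suc n)
    then obtain w where w: "awalk (Inl P) w (Inr (ln n))" "length w = 2 * n + 1"
      by blast
    let ?w = "[(Inr (ln n), Inl (pt (Suc n))), (Inl (pt (Suc n)), Inr (ln (Suc n)))]"
    have "incident p m (pt (Suc n)) (ln (Suc n))" "incident p m (pt (Suc n)) (ln n)"
      by (auto simp: incident_iff ln_def pt_def algebra_simps)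
    then have "awalk (Inr (ln n)) ?w (Inr (ln (Suc n)))"
      by (simp add: awalk_simps G_simps ln_def pt_def)
    with w have "awalk (Inl P) (w @ ?w) (Inr (ln (Suc n)))"
      by (blast intro: awalk_appendI)
    with w(2) show ?case
      by (intro exI[of _ "w @ ?w"]) simp
  qed
  moreover have "ln m = L"
    by (rule vecs_eqI[where m = m]) (use L in \<open>simp_all add: ln_def s\<close>)
  ultimately show ?thesis
    by metis
qed

text \<open>Opposite sides are joined by \<open>2 * m + 1\<close> edges, after reversal if
  necessary; equal sides cost one more edge to a neighbour.\<close>

lemma ex_short_awalk:
  assumes "u \<in> pverts G" "v \<in> pverts G"
  shows "\<exists>w. awalk u w v \<and> length w \<le> 2 * (m + 1)"
proof (cases u; cases v)
  fix P L assume "u = Inl P" "v = Inr L"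
  with assms ex_awalk_point_line[of P L] show ?thesis
    by (auto simp: G_simps)
next
  fix K P assume uv: "u = Inr K" "v = Inl P"
  with assms ex_awalk_point_line[of P K] obtain w where "awalk v w u" "length w = 2 * m + 1"
    by (auto simp: G_simps)
  then have "awalk u (rev_path w) v" "length (rev_path w) = 2 * m + 1"
    by (simp_all add: awalk_rev_path)
  then show ?thesis
    by (intro exI[of _ "rev_path w"]) simp
next
  fix P Q assume uv: "u = Inl P" "v = Inl Q"
  with assms ex_incident(2)[of m p Q] obtain L where L: "(Inr L, v) \<in> parcs G" "L \<in> vecs (Suc m)"
    by (auto simp: G_simps)
  with uv assms ex_awalk_point_line[of P L]
  obtain w where w: "awalk u w (Inr L)" "length w = 2 * m + 1"
    by (auto simp: G_simps)
  have "awalk (Inr L) [(Inr L, v)] v"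
    using L assms by (simp add: awalk_simps)
  with w have "awalk u (w @ [(Inr L, v)]) v"
    by (blast intro: awalk_appendI)
  with w show ?thesis
    by (intro exI[of _ "w @ [(Inr L, v)]"]) simp
next
  fix K L assume uv: "u = Inr K" "v = Inr L"
  with assms ex_incident(1)[of m p K] obtain P where P: "(u, Inl P) \<in> parcs G" "P \<in> vecs (Suc m)"
    by (auto simp: G_simps)
  with uv assms ex_awalk_point_line[of P L]
  obtain w where w: "awalk (Inl P) w v" "length w = 2 * m + 1"
    by (auto simp: G_simps)
  with P have "awalk u ((u, Inl P) # w) v"
    by (simp add: awalk_simps)
  with w show ?thesis
    by (intro exI[of _ "(u, Inl P) # w"]) simp
qed

section \<open>Lower bound\<close>

text \<open>\<open>X\<close> collects the first coordinates of the points on the walk. Sides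
  alternate and the walk ends at a line, so each point accounts for two edges, except that a
  starting point has only its outgoing edge; hence the summand 1.\<close>

lemma awalk_functional:
  assumes "awalk u w (Inr L)" and mn: "m = Suc n"
  shows "\<exists>X. finite X \<and> 2 * card X \<le> length w + (case u of Inl P \<Rightarrow> 1 | Inr L \<Rightarrow> 0)
    \<and> (\<forall>P. u = Inl P \<longrightarrow> P (Suc 0) \<in> X)
    \<and> (\<forall>a d. (\<forall>x\<in>X. affine_p_poly p n a d x = 0)
        \<longrightarrow> functional n a d u = functional n a d (Inr L))"
  using assms(1)
proof (induction w arbitrary: u)
  case Nil
  then show ?case
    by (intro exI[of _ "{}"]) (auto simp: awalk_simps)
next
  case (Cons arc w)
  then obtain v where arc: "arc = (u, v)" "(u, v) \<in> parcs G" "awalk v w (Inr L)"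
    by (cases arc) (auto simp: awalk_simps)
  from Cons.IH[OF this(3)] obtain X where X: "finite X"
    "2 * card X \<le> length w + (case v of Inl P \<Rightarrow> 1 | Inr L \<Rightarrow> 0)"
    "\<And>P. v = Inl P \<Longrightarrow> P (Suc 0) \<in> X"
    "\<And>a d. \<forall>x\<in>X. affine_p_poly p n a d x = 0 \<Longrightarrow> functional n a d v = functional n a d (Inr L)"
    by blast
  show ?case
  proof (cases u)
    case (Inl P)
    with arc obtain K where v: "v = Inr K" and "incident p m P K"
      by (cases v) (auto simp: G_simps)
    moreover have "card (insert (P (Suc 0)) X) \<le> Suc (card X)"
      by (rule card_insert_le_m1) simp_all
    ultimately show ?thesis
      using X Inl functional_eq_if_incident[of p n P K]
      by (intro exI[of _ "insert (P (Suc 0)) X"]) (auto simp: mn)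
  next
    case (Inr K)
    with arc obtain P where v: "v = Inl P" and "incident p m P K"
      by (cases v) (auto simp: G_simps)
    then show ?thesis
      using X Inr functional_eq_if_incident[of p n P K]
      by (intro exI[of _ X]) (auto simp: mn)
  qed
qed

lemma ex_distant_lines:
  "\<exists>K L. K \<in> vecs (Suc m) \<and> L \<in> vecs (Suc m) \<and>
    (\<forall>w. awalk (Inr K) w (Inr L) \<longrightarrow> 2 * (m + 1) \<le> length w)"
proof -
  obtain n where mn: "m = Suc n"
    using m(1) by (cases m) auto
  \<comment> \<open>Only the monic term sees the difference: the functional is 0 on \<open>K\<close>
    and 1 on \<open>L\<close> for all \<open>a\<close> and \<open>d\<close>.\<close>
  define K L :: "nat \<Rightarrow> 'a" where "K = vec m 0 (\<lambda>_. 0)" and "L = vec m 0 (\<lambda>j. if j = n then 1 else 0)"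
  have "2 * (m + 1) \<le> length w" if "awalk (Inr K) w (Inr L)" for w
  proof (rule ccontr)
    assume short: "\<not> ?thesis"
    from awalk_functional[OF that mn] obtain X where X: "finite X" "2 * card X \<le> length w"
      "\<And>a d. \<forall>x\<in>X. affine_p_poly p n a d x = 0 \<Longrightarrow>
        functional n a d (Inr K) = functional n a d (Inr L)"
      by auto
    \<comment> \<open>By parity, even length \<open>2 * m + 1\<close> allows at most
      \<open>m\<close> values.\<close>
    from X(2) short have "card X \<le> Suc n"
      by (simp add: mn)
    then obtain a d where "\<forall>x\<in>X. affine_p_poly p n a d x = 0"
      using ex_affine_p_poly_vanishing[OF p CHAR_eq_if_card_eq_prime_power[OF p card] X(1)] by blast
    from X(3)[OF this] show False
      by (simp add: functional_def K_def L_def mn)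
  qed
  then show ?thesis
    by (intro exI[of _ K] exI[of _ L]) (auto simp: K_def L_def)
qed

section \<open>The diameter\<close>

lemma diameter_eq: "diameter (with_proj G) = ereal (real (2 * (m + 1)))"
proof (rule antisym)
  have "\<mu> (\<lambda>_. 1) u v \<le> ereal (real (2 * (m + 1)))" if uv: "u \<in> pverts G" "v \<in> pverts G" for u v
  proof -
    obtain w where "awalk u w v" "length w \<le> 2 * (m + 1)"
      using ex_short_awalk[OF uv] by blast
    then have "\<mu> (\<lambda>_. 1) u v \<le> ereal (real (length w))" "real (length w) \<le> real (2 * (m + 1))"
      using min_cost_le_walk_cost[of u w v "\<lambda>_. 1"] unfolding awalk_cost_one of_nat_le_iff by auto
    then show ?thesis
      using ereal_less_eq(3) order.trans by blast
  qed
  then show "diameter (with_proj G) \<le> ereal (real (2 * (m + 1)))"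
    unfolding diameter_def by (intro SUP_least) auto
next
  obtain K L where KL: "K \<in> vecs (Suc m)" "L \<in> vecs (Suc m)"
    and long: "\<And>w. awalk (Inr K) w (Inr L) \<Longrightarrow> 2 * (m + 1) \<le> length w"
    using ex_distant_lines by blast
  have "ereal (real (2 * (m + 1))) \<le> \<mu> (\<lambda>_. 1) (Inr K) (Inr L)"
    unfolding \<mu>_def awalk_cost_one by (intro INF_greatest) (use long in force)
  also have "\<dots> \<le> diameter (with_proj G)"
    unfolding diameter_def
    by (rule SUP_upper2[of "(Inr K, Inr L)"]) (use KL in \<open>simp_all add: G_simps\<close>)
  finally show "ereal (real (2 * (m + 1))) \<le> diameter (with_proj G)" .
qed

end

theorem theorem4p1:
  fixes p e m q :: nat
  assumes "prime p"
    and "e \<ge> 1"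
    and "q = p ^ e"
    and "1 \<le> m" and "m \<le> e"
    and "card (UNIV :: 'a::{field, finite} set) = q"
  shows "diameter (with_proj (linearized_Wenger_graph p m ::
      ((nat \<Rightarrow> 'a) + (nat \<Rightarrow> 'a)) pair_pre_digraph)) = ereal (real (2 * (m + 1)))"
  using assms by (intro diameter_eq[where e = e]) simp_all

end
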